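(* Let $Y$ be a finite dimensional Euclidean space and $K\subseteq Y$ a closed convex cone. If $k\ge1$ and $(y_1,\dots,y_k)\in\mathrm{FR}_k(K)$ is strict, then $y_1,\dots,y_k$ are linearly independent. Moreover, let $H\subseteq Y$ be an affine subspace with $H\cap K\ne\emptyset$. Then the facial reduction algorithm (described in the context) applied to $H\cap K$ stops after at most $$\min\{\,\ell_K-1,\ \dim H^\perp\,\}$$ iterations.
   Context: Notation: $K^*=\{y\in Y:\langle y,x\rangle\ge0\ \forall x\in K\}$; for a convex set $S$, $S^\perp$ is the orthogonal complement of the linear span of $S$. For a closed convex cone $C$, $C^{*\setminus\perp}:=C^*\setminus C^\perp$. For $k\ge1$, $\mathrm{FR}_k(K)=\{(y_1,\dots,y_k): y_1\in K^*,\ y_i\in(K\cap y_1^\perp\cap\dots\cap y_{i-1}^\perp)^*,\ i=2,\dots,k\}$. An element $(y_1,\dots,y_k)\in\mathrm{FR}_k(K)$ is strict if $y_i\in(K\cap y_1^\perp\cap\dots\cap y_{i-1}^\perp)^{*\setminus\perp}$ for $i=1,\dots,k$ (for $i=1$ this means $y_1\in K^{*\setminus\perp}$). A convex subset $F$ of $K$ is a face of $K$ if $y,z\in K$ and $\frac12(y+z)\in F$ imply $y,z\in F$. $\ell_K$ is the length of the longest chain of nonempty faces, i.e. the largest $k$ such that there are nonempty faces $F_1\subsetneq F_2\subsetneq\dots\subsetneq F_k$ of $K$. Facial reduction algorithm: start with $F_0=K$, $i=1$. While $H^\perp\cap F_{i-1}^{*\setminus\perp}\neq\emptyset$: choose any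 $y_i\in H^\perp\cap F_{i-1}^{*\setminus\perp}$, let $F_i=F_{i-1}\cap y_i^\perp$, and increase $i$ by $1$. Each pass through the loop is one iteration. *)

theory Defs
  imports "HOL-Analysis.Analysis"
begin

definition dual_cone :: "'a::euclidean_space set \<Rightarrow> 'a set" where
  "dual_cone C = {y. \<forall>x\<in>C. 0 \<le> y \<bullet> x}"

definition perp :: "'a::euclidean_space set \<Rightarrow> 'a set" where
  "perp S = (span S)\<^sup>\<bottom>"

definition dual_minus_perp :: "'a::euclidean_space set \<Rightarrow> 'a set" where
  "dual_minus_perp C = dual_cone C - perp C"

text \<open>
  For a list \<open>ys\<close> and \<open>i \<le> length ys\<close>, \<open>fr_cut K ys i\<close> is the intersection of \<open>K\<close> with the
  orthogonal complements of the first \<open>i\<close> entries of \<open>ys\<close>. Lists are indexed from 0, so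
  \<open>ys ! i\<close> plays the role of \<open>y\<^sub>i\<^sub>+\<^sub>1\<close>, and \<open>fr_cut K ys 0 = K\<close>.
\<close>

definition fr_cut :: "'a::euclidean_space set \<Rightarrow> 'a list \<Rightarrow> nat \<Rightarrow> 'a set" where
  "fr_cut K ys i = K \<inter> (\<Inter>j<i. perp {ys ! j})"

definition FR :: "nat \<Rightarrow> 'a::euclidean_space set \<Rightarrow> 'a list set" where
  "FR k K = {ys. length ys = k \<and> (\<forall>i<k. ys ! i \<in> dual_cone (fr_cut K ys i))}"

definition strict_FR :: "'a::euclidean_space set \<Rightarrow> 'a list \<Rightarrow> bool" where
  "strict_FR K ys \<longleftrightarrow> (\<forall>i<length ys. ys ! i \<in> dual_minus_perp (fr_cut K ys i))"

text \<open>
  Faces are given by the library's \<^const>\<open>face_of\<close>, which tests all points of open segments.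
  For convex sets this is the same as testing midpoints only.
\<close>

lemma face_of_iff_midpoint:
  fixes K :: "'a::real_vector set"
  assumes "convex K"
  shows "F face_of K \<longleftrightarrow>
    F \<subseteq> K \<and> convex F \<and>
    (\<forall>y\<in>K. \<forall>z\<in>K. (1/2) *\<^sub>R (y + z) \<in> F \<longrightarrow> y \<in> F \<and> z \<in> F)"
    (is "?L \<longleftrightarrow> ?R")
proof
  assume L: ?L
  have "y \<in> F \<and> z \<in> F"
    if "y \<in> K" "z \<in> K" "(1/2) *\<^sub>R (y + z) \<in> F" for y z
  proof (cases "y = z")
    case True
    then show ?thesis using that by (simp flip: scaleR_2)
  next
    case False
    have "(1/2) *\<^sub>R (y + z) \<in> open_segment y z"
      using False unfolding in_segment
      by (intro conjI exI[of _ "1/2"]) (auto simp: scaleR_right_distrib)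
    then show ?thesis using L that by (meson face_ofD)
  qed
  then show ?R using L unfolding face_of_def by blast
next
  assume R: ?R
  have half: "a \<in> F \<and> (1 - 2 * u) *\<^sub>R a + (2 * u) *\<^sub>R b \<in> F"
    if "a \<in> K" "b \<in> K" "0 \<le> u" "u \<le> 1/2" "(1 - u) *\<^sub>R a + u *\<^sub>R b \<in> F" for a b u
  proof -
    have "(1 - 2 * u) *\<^sub>R a + (2 * u) *\<^sub>R b \<in> K"
      using assms that by (intro convexD) auto
    moreover have "(1/2) *\<^sub>R (a + ((1 - 2 * u) *\<^sub>R a + (2 * u) *\<^sub>R b)) = (1 - u) *\<^sub>R a + u *\<^sub>R b"
    proof -
      have "(1/2) *\<^sub>R (a + ((1 - 2 * u) *\<^sub>R a + (2 * u) *\<^sub>R b))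
          = (1/2 + (1/2) * (1 - 2 * u)) *\<^sub>R a + u *\<^sub>R b"
        by (simp add: scaleR_right_distrib scaleR_left_distrib)
      also have "1/2 + (1/2) * (1 - 2 * u) = 1 - u" by (simp add: field_simps)
      finally show ?thesis .
    qed
    ultimately show ?thesis using R that by metis
  qed
  have step: "a \<in> F"
    if "a \<in> K" "b \<in> K" "0 < v" "v < 1" "v *\<^sub>R a + (1 - v) *\<^sub>R b \<in> F" "1 \<le> 2 ^ m * v"
    for a b v and m :: nat
    using that
  proof (induction m arbitrary: v)
    case 0
    then show ?case by simp
  next
    case (Suc m)
    show ?case
    proof (cases "1/2 \<le> v")
      case True
      then show ?thesis using half[of a b "1 - v"] Suc.prems by simp
    next
      case False
      then have "(1 - 2 * v) *\<^sub>R b + (2 * v) *\<^sub>R a \<in> F"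
        using half[of b a v] Suc.prems by (simp add: add.commute)
      then have "(2 * v) *\<^sub>R a + (1 - 2 * v) *\<^sub>R b \<in> F"
        by (simp add: add.commute)
      moreover have "1 \<le> 2 ^ m * (2 * v)" using Suc.prems(6) by (simp add: mult_ac)
      ultimately show ?thesis using False Suc.prems Suc.IH[of "2 * v"] by simp
    qed
  qed
  have endpoint: "a \<in> F"
    if "a \<in> K" "b \<in> K" "0 < v" "v < 1" "v *\<^sub>R a + (1 - v) *\<^sub>R b \<in> F" for a b v
  proof -
    obtain m :: nat where "1 / v < 2 ^ m"
      using real_arch_pow[of 2 "1 / v"] by auto
    then have "1 \<le> 2 ^ m * v"
      using \<open>0 < v\<close> by (simp add: field_simps)
    then show ?thesis using step[of a b v m] that by simp
  qed
  have "a \<in> F \<and> b \<in> F" if ab: "a \<in> K" "b \<in> K" "x \<in> F" "x \<in> open_segment a b" for a b x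
  proof -
    obtain u where u: "0 < u" "u < 1" "x = (1 - u) *\<^sub>R a + u *\<^sub>R b"
      using ab(4) by (auto simp: in_segment)
    have "a \<in> F" using endpoint[of a b "1 - u"] u ab by simp
    moreover have "b \<in> F" using endpoint[of b a u] u ab by (simp add: add.commute)
    ultimately show ?thesis by simp
  qed
  then show ?L using R unfolding face_of_def by blast
qed

definition face_chain :: "'a::euclidean_space set \<Rightarrow> 'a set list \<Rightarrow> bool" where
  "face_chain K Fs \<longleftrightarrow>
    (\<forall>F\<in>set Fs. F face_of K \<and> F \<noteq> {}) \<and> sorted_wrt (\<subset>) Fs"

definition longest_face_chain :: "'a::euclidean_space set \<Rightarrow> nat" where
  "longest_face_chain K = Max {length Fs | Fs. face_chain K Fs}"

text \<open>The maximum is over a finite set, and it is positive when \<open>K\<close> is convex and nonempty.\<close>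

lemma finite_face_chain_lengths:
  fixes K :: "'a::euclidean_space set"
  assumes "convex K"
  shows "finite {length Fs | Fs. face_chain K Fs}"
proof -
  have bound: "length Fs \<le> DIM('a) + 1" if "face_chain K Fs" for Fs
  proof -
    have dim: "int i \<le> aff_dim (Fs ! i)" if "i < length Fs" for i
      using that
    proof (induction i)
      case 0
      then have "Fs ! 0 \<noteq> {}" using \<open>face_chain K Fs\<close> nth_mem unfolding face_chain_def by blast
      then show ?case using aff_dim_geq[of "Fs ! 0"] aff_dim_empty[of "Fs ! 0"] by simp
    next
      case (Suc i)
      have lt: "Fs ! i \<subset> Fs ! Suc i"
        using \<open>face_chain K Fs\<close> Suc.prems unfolding face_chain_def
        by (metis lessI sorted_wrt_nth_less)
      have f: "Fs ! i face_of K" "Fs ! Suc i face_of K"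
        using \<open>face_chain K Fs\<close> Suc.prems unfolding face_chain_def by auto
      have "Fs ! i face_of Fs ! Suc i"
        using f lt by (meson face_of_imp_subset face_of_subset psubset_imp_subset)
      then have "aff_dim (Fs ! i) < aff_dim (Fs ! Suc i)"
        using f lt by (intro face_of_aff_dim_lt) (auto dest: face_of_imp_convex)
      then show ?case using Suc by simp
    qed
    show ?thesis
    proof (rule ccontr)
      assume "\<not> ?thesis"
      then have "int (DIM('a) + 1) \<le> aff_dim (Fs ! (DIM('a) + 1))" by (intro dim) simp
      then show False using aff_dim_le_DIM[of "Fs ! (DIM('a) + 1)"] by simp
    qed
  qed
  show ?thesis by (rule finite_subset[of _ "{..DIM('a) + 1}"]) (use bound in auto)
qed

lemma longest_face_chain_pos:
  fixes K :: "'a::euclidean_space set"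
  assumes "convex K" "K \<noteq> {}"
  shows "1 \<le> longest_face_chain K"
proof -
  have "face_chain K [K]" using assms by (simp add: face_chain_def face_of_refl)
  then show ?thesis
    unfolding longest_face_chain_def
    by (intro Max_ge finite_face_chain_lengths assms) (auto intro!: exI[of _ "[K]"])
qed

text \<open>
  \<open>facial_reduction H K n F\<close>: some run of the facial reduction algorithm on \<open>H \<inter> K\<close>
  has completed \<open>n\<close> iterations with current face \<open>F\<close>. The vector \<open>y\<close> is an arbitrary choice
  of the algorithm, and the run goes on as long as such a \<open>y\<close> exists.
\<close>

inductive facial_reduction ::
    "'a::euclidean_space set \<Rightarrow> 'a set \<Rightarrow> nat \<Rightarrow> 'a set \<Rightarrow> bool"
  for H K where
  start: "facial_reduction H K 0 K"
| iterate: "facial_reduction H K n F \<Longrightarrow> y \<in> perp H \<inter> dual_minus_perp F \<Longrightarrow>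
    facial_reduction H K (Suc n) (F \<inter> perp {y})"

end

theory Submission
  imports Defs
begin

text \<open>
  Both bounds rest on one observation: a vector that is strictly dual to a cut
  \<open>K \<inter> y\<^sub>1\<^sup>\<bottom> \<inter> \<dots> \<inter> y\<^sub>i\<^sup>\<bottom>\<close> is not orthogonal to that cut, whereas every vector in the span of
  \<open>y\<^sub>1, \<dots>, y\<^sub>i\<close> is. So each new vector of a strict sequence lies outside the span of the earlier
  ones, which gives linear independence (\<open>strict_FR_independent\<close>).

  The vectors chosen by a run of the facial reduction algorithm form a strict sequence inside
  the subspace \<open>H\<^sup>\<bottom>\<close> (\<open>facial_reduction_strict_FR\<close>), so there are at most \<open>dim H\<^sup>\<bottom>\<close> of them.
  On the other hand, each iteration cuts the current face \<open>F\<close> with a supporting hyperplane through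
  the origin. The result is a face of \<open>F\<close>, hence of \<open>K\<close>; it still contains the origin; and it is
  strictly smaller because the chosen vector is not orthogonal to \<open>F\<close>. Together with \<open>K\<close>
  itself, \<open>n\<close> iterations yield a chain of \<open>n + 1\<close> nonempty faces
  (\<open>facial_reduction_face_chain\<close>).
\<close>

lemma mem_perp_iff: "y \<in> perp S \<longleftrightarrow> (\<forall>x\<in>S. y \<bullet> x = 0)"
proof
  assume "y \<in> perp S"
  then show "\<forall>x\<in>S. y \<bullet> x = 0"
    by (auto simp: perp_def orthogonal_comp_def orthogonal_def inner_commute span_base)
next
  assume "\<forall>x\<in>S. y \<bullet> x = 0"
  then have "orthogonal y x" if "x \<in> span S" for x
    using that by (intro orthogonal_to_span[of x S y]) (auto simp: orthogonal_def)
  then show "y \<in> perp S"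
    by (simp add: perp_def orthogonal_comp_def orthogonal_commute)
qed

lemma fr_cut_length: "fr_cut K ys (length ys) = K \<inter> perp (set ys)"
  by (auto simp: fr_cut_def mem_perp_iff all_set_conv_all_nth)

lemma fr_cut_append: "i \<le> length ys \<Longrightarrow> fr_cut K (ys @ zs) i = fr_cut K ys i"
  by (auto simp: fr_cut_def nth_append)

lemma strict_FR_snoc:
  "strict_FR K (ys @ [y]) \<longleftrightarrow>
     strict_FR K ys \<and> y \<in> dual_minus_perp (K \<inter> perp (set ys))"
  by (auto simp: strict_FR_def less_Suc_eq fr_cut_append nth_append fr_cut_length)

text \<open>A vector in the span of \<open>ys\<close> is orthogonal to everything orthogonal to \<open>ys\<close>.\<close>

lemma dual_minus_perp_not_in_span:
  assumes "y \<in> dual_minus_perp (K \<inter> perp S)"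
  shows "y \<notin> span S"
proof
  assume "y \<in> span S"
  have "y \<bullet> x = 0" if "x \<in> perp S" for x
  proof -
    have "orthogonal x y"
      using \<open>y \<in> span S\<close>
      by (rule orthogonal_to_span) (use that in \<open>auto simp: mem_perp_iff orthogonal_def\<close>)
    then show ?thesis
      by (simp add: orthogonal_def inner_commute)
  qed
  then have "y \<in> perp (K \<inter> perp S)"
    by (simp add: mem_perp_iff)
  then show False
    using assms by (simp add: dual_minus_perp_def)
qed

lemma strict_FR_independent:
  "strict_FR K ys \<Longrightarrow> distinct ys \<and> independent (set ys)"
proof (induction ys rule: rev_induct)
  case Nil
  then show ?case by (simp add: independent_empty)
next
  case (snoc y ys)
  then have "y \<notin> span (set ys)"
    by (auto simp: strict_FR_snoc dest: dual_minus_perp_not_in_span)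
  with snoc show ?case
    by (auto simp: strict_FR_snoc independent_insert span_base)
qed

lemma facial_reduction_strict_FR:
  assumes "facial_reduction H K n F"
  shows "\<exists>ys. length ys = n \<and> strict_FR K ys \<and> set ys \<subseteq> perp H \<and> F = K \<inter> perp (set ys)"
  using assms
proof induction
  case start
  show ?case
    by (rule exI[of _ "[]"]) (simp add: strict_FR_def mem_perp_iff set_eq_iff)
next
  case (iterate n F y)
  then obtain ys where ys: "length ys = n" "strict_FR K ys" "set ys \<subseteq> perp H"
      "F = K \<inter> perp (set ys)"
    by blast
  have "F \<inter> perp {y} = K \<inter> perp (set (ys @ [y]))"
    by (auto simp: ys(4) mem_perp_iff)
  then show ?case
    using iterate.hyps ys by (intro exI[of _ "ys @ [y]"]) (simp add: strict_FR_snoc)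
qed

lemma face_of_Int_perp:
  assumes "convex F" "y \<in> dual_cone F"
  shows "F \<inter> perp {y} face_of F"
proof -
  have "F \<inter> perp {y} = F \<inter> {x. y \<bullet> x = 0}"
    by (auto simp: mem_perp_iff inner_commute)
  then show ?thesis
    using assms by (auto simp: dual_cone_def intro: face_of_Int_supporting_hyperplane_ge)
qed

text \<open>
  The origin belongs to every face that the algorithm visits; this keeps the faces in the chain
  nonempty.
\<close>

lemma facial_reduction_face_chain:
  assumes "facial_reduction H K n F" and "convex_cone K"
  shows "0 \<in> F \<and> (\<exists>Fs. length Fs = n \<and> face_chain K (F # Fs))"
  using assms(1)
proof induction
  case start
  have "0 \<in> K" "convex K"
    using assms(2) by (auto simp: convex_cone_def convex_cone_contains_0)
  then show ?case
    by (auto simp: face_chain_def face_of_refl)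
next
  case (iterate n F y)
  then obtain Fs where Fs: "length Fs = n" "face_chain K (F # Fs)" and "0 \<in> F"
    by blast
  have y: "y \<in> dual_cone F" "y \<notin> perp F"
    using iterate.hyps by (auto simp: dual_minus_perp_def)
  have F: "F face_of K"
    using Fs by (simp add: face_chain_def)
  have face: "F \<inter> perp {y} face_of K"
    using face_of_trans[OF face_of_Int_perp F] face_of_imp_convex F y(1) by blast
  have zero: "0 \<in> F \<inter> perp {y}"
    using \<open>0 \<in> F\<close> by (simp add: mem_perp_iff)
  obtain x where "x \<in> F" "x \<notin> perp {y}"
    using y(2) by (auto simp: mem_perp_iff inner_commute)
  then have less: "F \<inter> perp {y} \<subset> F"
    by blast
  have "face_chain K ((F \<inter> perp {y}) # F # Fs)"
    using Fs(2) face zero less unfolding face_chain_def by (auto simp del: Int_iff)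
  then show ?case
    using zero Fs(1) by (intro conjI exI[of _ "F # Fs"]) auto
qed

lemma face_chain_length_le:
  assumes "convex K" "face_chain K Fs"
  shows "length Fs \<le> longest_face_chain K"
  unfolding longest_face_chain_def
  by (intro Max_ge finite_face_chain_lengths) (use assms in auto)

theorem theorem1:
  fixes K :: "'a::euclidean_space set"
  assumes "closed K" and "convex_cone K"
  shows "(\<forall>k ys. 1 \<le> k \<longrightarrow> ys \<in> FR k K \<longrightarrow> strict_FR K ys \<longrightarrow>
            distinct ys \<and> independent (set ys)) \<and>
         (\<forall>H. affine H \<longrightarrow> H \<inter> K \<noteq> {} \<longrightarrow>
            (\<forall>n F. facial_reduction H K n F \<longrightarrow>
               n \<le> min (longest_face_chain K - 1) (dim (perp H))))"
proof (intro conjI allI impI)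
  fix k ys
  assume "strict_FR K ys"
  then show "distinct ys" "independent (set ys)"
    by (simp_all add: strict_FR_independent)
next
  fix H n F
  assume run: "facial_reduction H K n F"
  obtain Fs where "length Fs = n" "face_chain K (F # Fs)"
    using facial_reduction_face_chain[OF run assms(2)] by blast
  then have "Suc n \<le> longest_face_chain K"
    using face_chain_length_le[of K "F # Fs"] assms(2) by (simp add: convex_cone_def)
  moreover have "n \<le> dim (perp H)"
  proof -
    obtain ys where ys: "length ys = n" "strict_FR K ys" "set ys \<subseteq> perp H"
      using facial_reduction_strict_FR[OF run] by blast
    then have "n = card (set ys)"
      using strict_FR_independent[OF ys(2)] by (simp add: distinct_card)
    then show ?thesis
      using strict_FR_independent[OF ys(2)] ys(3) independent_card_le_dim by metis
  qed
  ultimately show "n \<le> min (longest_face_chain K - 1) (dim (perp H))"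
    by simp
qed

end
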